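(* There does not exist a function $f\colon\mathbb{N}\to\mathbb{N}$ such that for every transversal matroid $M$ on a ground set $E=\{e_1,\ldots,e_n\}$, every total order $\preceq$ on $E$ with $e_1\prec\cdots\prec e_n$, and every $i\in\{0,\ldots,n-1\}$, the $i$-th width of the ZDD $\mathsf{Z}(\mathcal{I}(M))$ with respect to $(E,\preceq)$ is at most $f(\lambda_M(\{e_1,\ldots,e_i\}))$.
   Context: $M$ is transversal if there are subsets $A_1,\ldots,A_m\subseteq E$ such that $I\subseteq E$ is independent iff there is an injection $\varphi\colon I\to\{1,\ldots,m\}$ with $e\in A_{\varphi(e)}$ for all $e\in I$. $\mathcal{I}(M)$ is the collection of independent sets, $r_M$ the rank function, and $\lambda_M(X)=r_M(X)+r_M(E\setminus X)-r_M(E)$. The ZDD $\mathsf{Z}(\mathcal{S})$ of $\mathcal{S}\subseteq 2^E$ w.r.t. $(E,\preceq)$ is obtained from the complete binary decision tree of $\mathcal{S}$ (internal nodes at depth $j$ labeled $e_{j+1}$, each with a 0-arc to $\nu_0$ and 1-arc to $\nu_1$; the leaf reached by taking 1-arcs exactly at elements of $X$ is the terminal $\top$ iff $X\in\mathcal{S}$, else $\bot$) by exhaustively merging non-terminal nodes with the same label and same 0- and 1-successors, and removing every non-terminal $\nu$ with $\nu_1=\bot$ (redirecting arcs entering $\nu$ to $\nu_0$). The $i$-th width is the number of non-terminal nodes labeled $e_{i+1}$. *)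

theory Defs
  imports Main
begin

locale matroid =
  fixes E :: "'a set" and \<I> :: "'a set set"
  assumes finite_ground: "finite E"
    and indep_subset: "\<I> \<subseteq> Pow E"
    and indep_empty: "{} \<in> \<I>"
    and indep_mono: "\<And>X Y. Y \<in> \<I> \<Longrightarrow> X \<subseteq> Y \<Longrightarrow> X \<in> \<I>"
    and indep_augment: "\<And>X Y. X \<in> \<I> \<Longrightarrow> Y \<in> \<I> \<Longrightarrow> card X < card Y \<Longrightarrow>
      \<exists>y \<in> Y - X. insert y X \<in> \<I>"

definition transversal :: "'a set \<Rightarrow> 'a set set \<Rightarrow> bool" where
  "transversal E \<I> \<longleftrightarrow>
    (\<exists>(m::nat) A. (\<forall>k\<in>{1..m}. A k \<subseteq> E) \<and>
      (\<forall>I\<subseteq>E. I \<in> \<I> \<longleftrightarrow>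
        (\<exists>\<phi>. inj_on \<phi> I \<and> \<phi> ` I \<subseteq> {1..m} \<and> (\<forall>e\<in>I. e \<in> A (\<phi> e)))))"

definition rank_of :: "'a set set \<Rightarrow> 'a set \<Rightarrow> nat" where
  "rank_of \<I> X = Max (card ` {I \<in> \<I>. I \<subseteq> X})"

text \<open>The truncated subtraction is harmless: the rank function of a matroid is subadditive.\<close>

definition connectivity :: "'a set \<Rightarrow> 'a set set \<Rightarrow> 'a set \<Rightarrow> nat" where
  "connectivity E \<I> X = rank_of \<I> X + rank_of \<I> (E - X) - rank_of \<I> E"

datatype 'v vertex = Bot | Top | Inner 'v

text \<open>Only the values of \<open>label\<close>, \<open>lo\<close> (0-arc) and \<open>hi\<close> (1-arc) on \<open>nodes\<close>, the set of
  non-terminal nodes, are meaningful. The field \<open>root\<close> plays the role of an arc entering the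
  root, so that the root itself may be merged or removed.\<close>

record ('a, 'v) diagram =
  root :: "'v vertex"
  nodes :: "'v set"
  label :: "'v \<Rightarrow> 'a"
  lo :: "'v \<Rightarrow> 'v vertex"
  hi :: "'v \<Rightarrow> 'v vertex"

text \<open>The list \<open>es\<close> is the ground set enumerated in increasing order, so that \<open>es ! j\<close> is the
  element \<open>e\<^bsub>j+1\<^esub>\<close>. A node of the decision tree is identified with the sequence of arcs leading
  to it from the root, where \<open>True\<close> stands for a 1-arc.\<close>

definition selected :: "'a list \<Rightarrow> bool list \<Rightarrow> 'a set" where
  "selected es p = {es ! j | j. j < length p \<and> p ! j}"

definition tree_vertex :: "'a list \<Rightarrow> 'a set set \<Rightarrow> bool list \<Rightarrow> bool list vertex" where
  "tree_vertex es \<S> p =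
    (if length p < length es then Inner p else if selected es p \<in> \<S> then Top else Bot)"

definition decision_tree :: "'a list \<Rightarrow> 'a set set \<Rightarrow> ('a, bool list) diagram" where
  "decision_tree es \<S> =
    \<lparr> root = tree_vertex es \<S> [],
      nodes = {p. length p < length es},
      label = (\<lambda>p. es ! length p),
      lo = (\<lambda>p. tree_vertex es \<S> (p @ [False])),
      hi = (\<lambda>p. tree_vertex es \<S> (p @ [True])) \<rparr>"

definition redirect :: "'v \<Rightarrow> 'v vertex \<Rightarrow> ('a, 'v) diagram \<Rightarrow> ('a, 'v) diagram" where
  "redirect v w D =
    (let \<rho> = (\<lambda>x. if x = Inner v then w else x) in
      \<lparr> root = \<rho> (root D), nodes = nodes D - {v}, label = label D,
        lo = \<rho> \<circ> lo D, hi = \<rho> \<circ> hi D \<rparr>)"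

inductive reduce_step :: "('a, 'v) diagram \<Rightarrow> ('a, 'v) diagram \<Rightarrow> bool" where
  merge: "u \<in> nodes D \<Longrightarrow> v \<in> nodes D \<Longrightarrow> u \<noteq> v \<Longrightarrow> label D u = label D v \<Longrightarrow>
    lo D u = lo D v \<Longrightarrow> hi D u = hi D v \<Longrightarrow> reduce_step D (redirect v (Inner u) D)"
| remove: "v \<in> nodes D \<Longrightarrow> hi D v = Bot \<Longrightarrow> reduce_step D (redirect v (lo D v) D)"

definition is_ZDD :: "'a list \<Rightarrow> 'a set set \<Rightarrow> ('a, bool list) diagram \<Rightarrow> bool" where
  "is_ZDD es \<S> Z \<longleftrightarrow> reduce_step\<^sup>*\<^sup>* (decision_tree es \<S>) Z \<and> (\<nexists>Z'. reduce_step Z Z')"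

lemma finite_nodes_decision_tree: "finite (nodes (decision_tree es \<S>))"
proof -
  have "{p::bool list. length p < length es} \<subseteq> {p. set p \<subseteq> UNIV \<and> length p \<le> length es}"
    by auto
  then show ?thesis
    unfolding decision_tree_def diagram.simps
    by (rule finite_subset) (rule finite_lists_length_le, rule finite_UNIV)
qed

lemma nodes_reduce_step: "reduce_step D D' \<Longrightarrow> nodes D' \<subset> nodes D"
  by (induction rule: reduce_step.induct) (auto simp: redirect_def Let_def)

lemma is_ZDD_exists: "\<exists>Z. is_ZDD es \<S> Z"
proof -
  have "\<exists>Z. reduce_step\<^sup>*\<^sup>* D Z \<and> (\<nexists>Z'. reduce_step Z Z')" if "finite (nodes D)"
    for D :: "('a, bool list) diagram"
    using that
  proof (induction "card (nodes D)" arbitrary: D rule: less_induct)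
    case less
    show ?case
    proof (cases "\<exists>D'. reduce_step D D'")
      case True
      then obtain D' where D': "reduce_step D D'" by blast
      then have "nodes D' \<subset> nodes D" by (rule nodes_reduce_step)
      then have "card (nodes D') < card (nodes D)" "finite (nodes D')"
        using less.prems by (simp_all add: psubset_card_mono psubset_imp_subset finite_subset[of "nodes D'" "nodes D"])
      then obtain Z where "reduce_step\<^sup>*\<^sup>* D' Z" "\<nexists>Z'. reduce_step Z Z'"
        using less.hyps by blast
      moreover from D' this(1) have "reduce_step\<^sup>*\<^sup>* D Z"
        by (rule converse_rtranclp_into_rtranclp)
      ultimately show ?thesis by blast
    next
      case False
      then show ?thesis by (intro exI[of _ D]) simp
    qed
  qed
  from this[OF finite_nodes_decision_tree] show ?thesis
    unfolding is_ZDD_def .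
qed

text \<open>The fully reduced diagram does not depend on the order of the reduction steps up to
  renaming of nodes; \<open>SOME\<close> merely fixes the names.\<close>

definition ZDD :: "'a list \<Rightarrow> 'a set set \<Rightarrow> ('a, bool list) diagram" where
  "ZDD es \<S> = (SOME Z. is_ZDD es \<S> Z)"

definition width :: "'a list \<Rightarrow> ('a, 'v) diagram \<Rightarrow> nat \<Rightarrow> nat" where
  "width es Z i = card {v \<in> nodes Z. label Z v = es ! i}"

end

theory Submission
  imports Defs
begin

text \<open>
  Take the ground set \<open>{..<2 * s}\<close>, split into the pairs \<open>{j, s + j}\<close> for \<open>j < s\<close>, and call a set
  independent if it contains at most \<open>s - 2\<close> full pairs. This matroid is transversal, presented by
  the pairs together with \<open>s - 2\<close> copies of the ground set. Both halves \<open>{..<s}\<close> and \<open>{s..<2 * s}\<close>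
  are independent and the rank is \<open>2 * s - 2\<close>, so the halves have connectivity \<open>2\<close>. However, the sets
  \<open>{..<s} - {j}\<close> have pairwise different families of independent completions in the second half:
  the completion omitting only \<open>s + j\<close> is forbidden for \<open>j\<close> and allowed for all others.
  Each of these families needs a node of its own, so the width is at least \<open>s\<close>.
\<close>

section \<open>Residual families and a lower bound for the width\<close>

text \<open>The completions, by still undecided elements, of the choices made along
  \<open>p\<close>. They play the role of the subfunction computed below a node.\<close>

definition residual :: "'a list \<Rightarrow> 'a set set \<Rightarrow> bool list \<Rightarrow> 'a set set" where
  "residual es \<S> p = {Y. Y \<subseteq> set (drop (length p) es) \<and> selected es p \<union> Y \<in> \<S>}"

text \<open>An inner node is interpreted through its name in the original tree, so its meaning
  survives every reduction. \<open>Top\<close> has the same family at every depth because elements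
  skipped by an arc count as absent.\<close>

primrec vertex_family :: "'a list \<Rightarrow> 'a set set \<Rightarrow> bool list vertex \<Rightarrow> 'a set set" where
  "vertex_family es \<S> Bot = {}"
| "vertex_family es \<S> Top = {{}}"
| "vertex_family es \<S> (Inner p) = residual es \<S> p"

lemma selected_snoc:
  "selected es (p @ [b]) = (if b then insert (es ! length p) (selected es p) else selected es p)"
proof -
  have "selected es q = (!) es ` {j. j < length q \<and> q ! j}" for q
    by (auto simp: selected_def)
  moreover have "{j. j < length (p @ [b]) \<and> (p @ [b]) ! j} =
      (if b then insert (length p) {j. j < length p \<and> p ! j} else {j. j < length p \<and> p ! j})"
    by (auto simp: nth_append less_Suc_eq)
  ultimately show ?thesis by simp
qed

lemma vertex_family_tree_vertex:
  assumes "length p \<le> length es"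
  shows "vertex_family es \<S> (tree_vertex es \<S> p) = residual es \<S> p"
  using assms by (auto simp: tree_vertex_def residual_def)

lemma residual_snoc_False:
  assumes "distinct es" "length p < length es"
  shows "residual es \<S> (p @ [False]) = {Y \<in> residual es \<S> p. es ! length p \<notin> Y}"
proof -
  have "es ! length p \<notin> set (drop (Suc (length p)) es)"
    using assms by (metis Cons_nth_drop_Suc distinct.simps(2) distinct_drop)
  moreover have "set (drop (length p) es) = insert (es ! length p) (set (drop (Suc (length p)) es))"
    using assms by (metis Cons_nth_drop_Suc list.simps(15))
  ultimately show ?thesis
    by (auto simp: residual_def selected_snoc)
qed

lemma residual_snoc_True:
  assumes "distinct es" "length p < length es"
  shows "residual es \<S> (p @ [True]) =
    {Y. es ! length p \<notin> Y \<and> insert (es ! length p) Y \<in> residual es \<S> p}"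
proof -
  have "es ! length p \<notin> set (drop (Suc (length p)) es)"
    using assms by (metis Cons_nth_drop_Suc distinct.simps(2) distinct_drop)
  moreover have "set (drop (length p) es) = insert (es ! length p) (set (drop (Suc (length p)) es))"
    using assms by (metis Cons_nth_drop_Suc list.simps(15))
  ultimately show ?thesis
    by (auto simp: residual_def selected_snoc)
qed

text \<open>Completions are split by whether they contain the next element. Hence the families of
  the two children determine that of the parent, and an empty 1-family makes the parent agree with
  its 0-child.\<close>

lemma residual_eq_Un:
  assumes "distinct es" "length p < length es"
  shows "residual es \<S> p =
    residual es \<S> (p @ [False]) \<union> insert (es ! length p) ` residual es \<S> (p @ [True])"
proof -
  have "Y \<in> insert (es ! length p) ` residual es \<S> (p @ [True])"
    if "Y \<in> residual es \<S> p" "es ! length p \<in> Y" for Y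
    using that assms
    by (intro image_eqI[of _ _ "Y - {es ! length p}"]) (auto simp: residual_snoc_True insert_absorb)
  then show ?thesis
    using assms by (auto simp: residual_snoc_False residual_snoc_True)
qed

text \<open>Invariant of the reduction. Arcs keep the families of the original tree, and each family
  of a level keeps a representative there. Only families with an empty 1-family may lose theirs,
  since the removal rule deletes such nodes.\<close>

definition faithful :: "'a list \<Rightarrow> 'a set set \<Rightarrow> ('a, bool list) diagram \<Rightarrow> bool" where
  "faithful es \<S> D \<longleftrightarrow>
    (\<forall>v \<in> nodes D. length v < length es \<and> label D v = es ! length v \<and>
       vertex_family es \<S> (lo D v) = residual es \<S> (v @ [False]) \<and>
       vertex_family es \<S> (hi D v) = residual es \<S> (v @ [True])) \<and>
    (\<forall>p. length p < length es \<longrightarrow> residual es \<S> (p @ [True]) \<noteq> {} \<longrightarrow>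
       (\<exists>v \<in> nodes D. length v = length p \<and> residual es \<S> v = residual es \<S> p))"

lemma faithful_decision_tree: "faithful es \<S> (decision_tree es \<S>)"
  by (auto simp: faithful_def decision_tree_def vertex_family_tree_vertex)

text \<open>The common core of both reduction rules: \<open>fam\<close> keeps the arcs into
  \<open>v\<close> correct, and \<open>repl\<close> supplies another representative when
  \<open>v\<close> must have one.\<close>

lemma faithful_redirect:
  assumes D: "faithful es \<S> D"
    and fam: "vertex_family es \<S> w = residual es \<S> v"
    and repl: "residual es \<S> (v @ [True]) \<noteq> {} \<Longrightarrow>
      \<exists>u \<in> nodes D - {v}. length u = length v \<and> residual es \<S> u = residual es \<S> v"
    and dist: "distinct es"
  shows "faithful es \<S> (redirect v w D)"
proof -
  have "\<exists>u \<in> nodes D - {v}. length u = length p \<and> residual es \<S> u = residual es \<S> p"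
    if p: "length p < length es" "residual es \<S> (p @ [True]) \<noteq> {}" for p
  proof -
    obtain u where u: "u \<in> nodes D" "length u = length p" "residual es \<S> u = residual es \<S> p"
      using D p unfolding faithful_def by blast
    \<comment> \<open>At a fixed depth the 1-family depends only on the family itself, so it passes
      from \<open>p\<close> to \<open>u\<close>. This is what \<open>repl\<close> needs if
      \<open>u = v\<close>.\<close>
    then have "residual es \<S> (u @ [True]) \<noteq> {}"
      using p dist by (simp add: residual_snoc_True)
    then show ?thesis
      using u repl by (cases "u = v") auto
  qed
  then show ?thesis
    using D fam by (auto simp: faithful_def redirect_def Let_def)
qed

lemma faithful_reduce_step:
  assumes "reduce_step D D'" "faithful es \<S> D" "distinct es"
  shows "faithful es \<S> D'"
  using assms
proof cases
  case (merge u v)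
  have len: "length u < length es" "length v < length es"
    and "es ! length u = es ! length v"
    using merge assms(2) by (auto simp: faithful_def)
  \<comment> \<open>The entries of \<open>es\<close> are distinct, so equal labels force equal
    depth.\<close>
  then have "length u = length v"
    using assms(3) by (simp add: nth_eq_iff_index_eq)
  moreover have "residual es \<S> (x @ [b]) = vertex_family es \<S> (if b then hi D x else lo D x)"
    if "x \<in> nodes D" for x b
    using that assms(2) by (simp add: faithful_def)
  then have "residual es \<S> (u @ [b]) = residual es \<S> (v @ [b])" for b
    using merge(2,3,6,7) by simp
  ultimately have "residual es \<S> u = residual es \<S> v"
    using residual_eq_Un[OF assms(3) len(1), of \<S>] residual_eq_Un[OF assms(3) len(2), of \<S>]
    by simp
  moreover have "u \<in> nodes D - {v}"
    using merge by simp
  ultimately show ?thesis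
    unfolding merge(1) using \<open>length u = length v\<close> assms(2,3)
    by (intro faithful_redirect) auto
next
  case (remove v)
  then have v: "length v < length es"
    "vertex_family es \<S> (lo D v) = residual es \<S> (v @ [False])" "residual es \<S> (v @ [True]) = {}"
    using assms(2) unfolding faithful_def by force+
  then have "vertex_family es \<S> (lo D v) = residual es \<S> v"
    using residual_eq_Un[OF assms(3) v(1), of \<S>] by simp
  \<comment> \<open>The 1-family of \<open>v\<close> is empty, so no replacement for
    \<open>v\<close> is required.\<close>
  then show ?thesis
    unfolding remove(1) using assms(2,3) v(3) by (intro faithful_redirect) auto
qed

lemma faithful_ZDD:
  assumes "distinct es"
  shows "faithful es \<S> (ZDD es \<S>)" "nodes (ZDD es \<S>) \<subseteq> nodes (decision_tree es \<S>)"
proof -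
  have "is_ZDD es \<S> (ZDD es \<S>)"
    unfolding ZDD_def by (rule someI_ex) (rule is_ZDD_exists)
  then have "reduce_step\<^sup>*\<^sup>* (decision_tree es \<S>) (ZDD es \<S>)"
    by (simp add: is_ZDD_def)
  then have "faithful es \<S> (ZDD es \<S>) \<and> nodes (ZDD es \<S>) \<subseteq> nodes (decision_tree es \<S>)"
  proof induction
    case base
    show ?case by (simp add: faithful_decision_tree)
  next
    case (step D D')
    then show ?case
      using faithful_reduce_step[of D D'] nodes_reduce_step[of D D'] assms by blast
  qed
  then show "faithful es \<S> (ZDD es \<S>)" "nodes (ZDD es \<S>) \<subseteq> nodes (decision_tree es \<S>)"
    by auto
qed

text \<open>By the invariant each of these families has a node on level \<open>i\<close>, and
  different families need different nodes. The level is finite because reduction only deletes nodes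
  of the decision tree.\<close>

lemma card_residual_le_width:
  assumes dist: "distinct es" and i: "i < length es"
    and P: "\<And>p. p \<in> P \<Longrightarrow> length p = i \<and> residual es \<S> (p @ [True]) \<noteq> {}"
  shows "card (residual es \<S> ` P) \<le> width es (ZDD es \<S>) i"
proof -
  let ?N = "{v \<in> nodes (ZDD es \<S>). label (ZDD es \<S>) v = es ! i}"
  have fin: "finite ?N"
    using faithful_ZDD(2)[OF dist, of \<S>] finite_nodes_decision_tree[of es \<S>]
    by (simp add: finite_subset)
  have "residual es \<S> ` P \<subseteq> residual es \<S> ` ?N"
  proof
    fix F assume "F \<in> residual es \<S> ` P"
    then obtain p where p: "p \<in> P" "F = residual es \<S> p" by blast
    then obtain v where v: "v \<in> nodes (ZDD es \<S>)" "length v = i" "residual es \<S> v = F"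
      using faithful_ZDD(1)[OF dist, of \<S>] P[OF p(1)] i unfolding faithful_def by blast
    then have "label (ZDD es \<S>) v = es ! i"
      using faithful_ZDD(1)[OF dist, of \<S>] by (simp add: faithful_def)
    with v show "F \<in> residual es \<S> ` ?N" by blast
  qed
  then have "card (residual es \<S> ` P) \<le> card (residual es \<S> ` ?N)"
    using fin by (intro card_mono) auto
  also have "\<dots> \<le> card ?N"
    using fin by (rule card_image_le)
  finally show ?thesis
    by (simp add: width_def)
qed

section \<open>Matroids bounding the number of full pairs\<close>

definition full_pairs :: "nat \<Rightarrow> nat set \<Rightarrow> nat set" where
  "full_pairs s I = {j. j < s \<and> j \<in> I \<and> s + j \<in> I}"

definition touched_pairs :: "nat \<Rightarrow> nat set \<Rightarrow> nat set" where
  "touched_pairs s I = {j. j < s \<and> (j \<in> I \<or> s + j \<in> I)}"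

definition pair_indep :: "nat \<Rightarrow> nat \<Rightarrow> nat set set" where
  "pair_indep s t = {I. I \<subseteq> {..<2 * s} \<and> card (full_pairs s I) \<le> t}"

lemma finite_full_pairs [simp]: "finite (full_pairs s I)"
  by (simp add: full_pairs_def)

lemma finite_touched_pairs [simp]: "finite (touched_pairs s I)"
  by (simp add: touched_pairs_def)

lemma card_touched_pairs_le: "card (touched_pairs s I) \<le> s"
  using card_mono[of "{..<s}" "touched_pairs s I"] by (auto simp: touched_pairs_def)

text \<open>Inclusion-exclusion for the pair indices met in the lower half (\<open>P\<close>) and in
  the upper half (\<open>Q\<close>).\<close>

lemma card_eq_touched_plus_full:
  assumes "I \<subseteq> {..<2 * s}"
  shows "card I = card (touched_pairs s I) + card (full_pairs s I)"
proof -
  define P where "P = {j. j < s \<and> j \<in> I}"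
  define Q where "Q = {j. j < s \<and> s + j \<in> I}"
  have "x \<in> (+) s ` Q" if "x \<in> I" "\<not> x < s" for x
    using that assms by (intro image_eqI[of _ _ "x - s"]) (auto simp: Q_def)
  then have "I = P \<union> (+) s ` Q"
    by (auto simp: P_def Q_def)
  also have "card \<dots> = card P + card ((+) s ` Q)"
    by (rule card_Un_disjoint) (auto simp: P_def Q_def)
  also have "card ((+) s ` Q) = card Q"
    by (simp add: card_image)
  also have "card P + card Q = card (P \<union> Q) + card (P \<inter> Q)"
    by (rule card_Un_Int) (auto simp: P_def Q_def)
  also have "P \<union> Q = touched_pairs s I"
    by (auto simp: P_def Q_def touched_pairs_def)
  also have "P \<inter> Q = full_pairs s I"
    by (auto simp: P_def Q_def full_pairs_def)
  finally show ?thesis .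
qed

lemma pair_indep_mono:
  assumes "Y \<in> pair_indep s t" "X \<subseteq> Y"
  shows "X \<in> pair_indep s t"
proof -
  have "card (full_pairs s X) \<le> card (full_pairs s Y)"
    using assms(2) by (intro card_mono) (auto simp: full_pairs_def)
  then show ?thesis
    using assms by (auto simp: pair_indep_def)
qed

text \<open>Below the bound any new element works, as it completes at most one pair. At the bound
  \<open>X\<close> has at least as many full pairs as \<open>Y\<close>, so the larger
  \<open>Y\<close> touches a pair that \<open>X\<close> misses; an element of that pair completes
  none.\<close>

lemma pair_indep_augment:
  assumes X: "X \<in> pair_indep s t" and Y: "Y \<in> pair_indep s t" and less: "card X < card Y"
  shows "\<exists>y \<in> Y - X. insert y X \<in> pair_indep s t"
proof (cases "card (full_pairs s X) < t")
  case True
  have "finite X"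
    using X finite_subset[of X "{..<2 * s}"] by (simp add: pair_indep_def)
  then have "\<not> Y \<subseteq> X"
    using less card_mono[of X Y] by auto
  then obtain y where y: "y \<in> Y - X" by blast
  \<comment> \<open>\<open>y mod s\<close> is the index of the pair containing
    \<open>y\<close>.\<close>
  have "full_pairs s (insert y X) \<subseteq> insert (y mod s) (full_pairs s X)"
    by (auto simp: full_pairs_def)
  then have "card (full_pairs s (insert y X)) \<le> card (insert (y mod s) (full_pairs s X))"
    by (intro card_mono) auto
  also have "\<dots> \<le> Suc (card (full_pairs s X))"
    by (simp add: card_insert_if)
  finally show ?thesis
    using True X Y y by (auto simp: pair_indep_def)
next
  case False
  then have full: "card (full_pairs s X) = t"
    using X by (simp add: pair_indep_def)
  have "\<not> touched_pairs s Y \<subseteq> touched_pairs s X"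
  proof
    assume "touched_pairs s Y \<subseteq> touched_pairs s X"
    then have "card (touched_pairs s Y) \<le> card (touched_pairs s X)"
      by (intro card_mono) auto
    then show False
      using less full X Y by (auto simp: card_eq_touched_plus_full pair_indep_def)
  qed
  then obtain j where j: "j < s" "j \<notin> X" "s + j \<notin> X" "j \<in> Y \<or> s + j \<in> Y"
    by (auto simp: touched_pairs_def)
  then obtain y where y: "y \<in> Y" "y = j \<or> y = s + j" by blast
  then have "full_pairs s (insert y X) = full_pairs s X"
    using j by (auto simp: full_pairs_def)
  then show ?thesis
    using j y X Y full by (auto simp: pair_indep_def intro!: bexI[of _ y])
qed

lemma matroid_pair_indep: "matroid {..<2 * s} (pair_indep s t)"
proof
  show "{} \<in> pair_indep s t"
    by (simp add: pair_indep_def full_pairs_def)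
  show "pair_indep s t \<subseteq> Pow {..<2 * s}"
    by (auto simp: pair_indep_def)
qed (auto intro: pair_indep_mono pair_indep_augment)

section \<open>Transversal presentation\<close>

lemma transversal_pair_indep: "transversal {..<2 * s} (pair_indep s t)"
proof -
  \<comment> \<open>Indices start at 1, so pair \<open>j\<close> is \<open>A (Suc j)\<close>; the
    indices above \<open>s\<close> are the copies of the ground set.\<close>
  define A where "A k = (if k \<le> s then {k - 1, s + (k - 1)} else {..<2 * s})" for k
  have "\<exists>\<phi>. inj_on \<phi> I \<and> \<phi> ` I \<subseteq> {1..s + t} \<and> (\<forall>e\<in>I. e \<in> A (\<phi> e))"
    if I: "I \<in> pair_indep s t" for I
  proof -
    have "card (full_pairs s I) \<le> card {s<..s + t}"
      using I by (simp add: pair_indep_def)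
    then obtain g where g: "inj_on g (full_pairs s I)" "g ` full_pairs s I \<subseteq> {s<..s + t}"
      using card_le_inj[of "full_pairs s I" "{s<..s + t}"] by auto
    \<comment> \<open>The upper element of a full pair is sent by \<open>g\<close> to a copy of the
      ground set, every other element to its own pair. No pair is then used twice, and
      \<open>g\<close> is injective with values above \<open>s\<close>.\<close>
    define \<phi> where "\<phi> e = (if e < s then Suc e
        else if e - s \<in> I then g (e - s) else Suc (e - s))" for e
    have sub: "e < 2 * s" if "e \<in> I" for e
      using that I by (auto simp: pair_indep_def)
    have gr: "s < g (e - s) \<and> g (e - s) \<le> s + t \<and> e - s \<in> full_pairs s I"
      if "e \<in> I" "\<not> e < s" "e - s \<in> I" for e
    proof -
      have "e - s \<in> full_pairs s I"
        using that sub[of e] by (auto simp: full_pairs_def)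
      with g(2) show ?thesis by auto
    qed
    have "inj_on \<phi> I"
    proof (rule inj_onI)
      fix x y assume xy: "x \<in> I" "y \<in> I" "\<phi> x = \<phi> y"
      have "g (x - s) = g (y - s) \<Longrightarrow> x = y"
        if "\<not> x < s" "x - s \<in> I" "\<not> y < s" "y - s \<in> I"
        using that gr[of x] gr[of y] xy inj_onD[OF g(1), of "x - s" "y - s"] by auto
      then show "x = y"
        using xy gr[of x] gr[of y] sub[of x] sub[of y]
        by (auto simp: \<phi>_def split: if_splits)
    qed
    moreover have "\<phi> e \<in> {1..s + t} \<and> e \<in> A (\<phi> e)" if "e \<in> I" for e
      using that gr[of e] sub[of e] by (auto simp: \<phi>_def A_def)
    ultimately show ?thesis by blast
  qed
  moreover have "I \<in> pair_indep s t"
    if I: "I \<subseteq> {..<2 * s}" and \<phi>: "inj_on \<phi> I" "\<phi> ` I \<subseteq> {1..s + t}" "\<forall>e\<in>I. e \<in> A (\<phi> e)" for I \<phi>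
  proof -
    \<comment> \<open>Only touched pairs and the \<open>t\<close> copies can serve as values, so
      \<open>card I\<close> exceeds the number of touched pairs by at most \<open>t\<close>. That
      excess is the number of full pairs.\<close>
    have "\<phi> e \<in> Suc ` touched_pairs s I \<union> {s<..s + t}" if "e \<in> I" for e
    proof (cases "\<phi> e \<le> s")
      case True
      have e: "1 \<le> \<phi> e" "e = \<phi> e - 1 \<or> e = s + (\<phi> e - 1)"
        using True that \<phi> by (auto simp: A_def)
      then have "\<phi> e - 1 \<in> touched_pairs s I"
        using True that by (auto simp: touched_pairs_def)
      with e show ?thesis
        by (intro UnI1 image_eqI[of _ _ "\<phi> e - 1"]) auto
    next
      case False
      then show ?thesis using that \<phi>(2) by auto
    qed
    then have "\<phi> ` I \<subseteq> Suc ` touched_pairs s I \<union> {s<..s + t}"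
      by blast
    then have "card (\<phi> ` I) \<le> card (Suc ` touched_pairs s I \<union> {s<..s + t})"
      by (intro card_mono) auto
    also have "\<dots> \<le> card (Suc ` touched_pairs s I) + card {s<..s + t}"
      by (rule card_Un_le)
    also have "\<dots> = card (touched_pairs s I) + t"
      by (simp add: card_image)
    finally have "card (full_pairs s I) \<le> t"
      using card_eq_touched_plus_full[OF I] \<phi>(1) by (simp add: card_image)
    then show ?thesis
      using I by (simp add: pair_indep_def)
  qed
  moreover have "\<forall>k\<in>{1..s + t}. A k \<subseteq> {..<2 * s}"
    by (auto simp: A_def)
  ultimately show ?thesis
    unfolding transversal_def
    by (intro exI[of _ "s + t"] exI[of _ A] conjI allI impI iffI) (assumption | elim exE conjE)+
qed

section \<open>Rank and connectivity\<close>

lemma rank_of_eqI: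
  assumes "finite \<I>" "B \<in> \<I>" "B \<subseteq> X" "\<And>I. I \<in> \<I> \<Longrightarrow> I \<subseteq> X \<Longrightarrow> card I \<le> card B"
  shows "rank_of \<I> X = card B"
  unfolding rank_of_def using assms by (intro Max_eqI) auto

lemma rank_of_indep:
  assumes "finite \<I>" "X \<in> \<I>" "finite X"
  shows "rank_of \<I> X = card X"
  using assms by (intro rank_of_eqI) (simp_all add: card_mono)

lemma finite_pair_indep: "finite (pair_indep s t)"
  by (rule finite_subset[of _ "Pow {..<2 * s}"]) (auto simp: pair_indep_def)

lemma connectivity_pair_indep:
  assumes "t \<le> s"
  shows "connectivity {..<2 * s} (pair_indep s t) {..<s} = s - t"
proof -
  have 1: "rank_of (pair_indep s t) {..<s} = card {..<s}"
    by (rule rank_of_indep) (auto simp: finite_pair_indep pair_indep_def full_pairs_def)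
  have "full_pairs s {s..<2 * s} = {}"
    by (auto simp: full_pairs_def)
  then have 2: "rank_of (pair_indep s t) {s..<2 * s} = card {s..<2 * s}"
    by (intro rank_of_indep) (auto simp: finite_pair_indep pair_indep_def)
  \<comment> \<open>\<open>{..<s + t}\<close> serves as a basis: it touches all \<open>s\<close>
    pairs and fills exactly \<open>t\<close> of them, the maximum of both counts.\<close>
  have full: "full_pairs s {..<s + t} = {..<t}"
    using assms by (auto simp: full_pairs_def)
  have 3: "rank_of (pair_indep s t) {..<2 * s} = card {..<s + t}"
  proof (rule rank_of_eqI)
    show "{..<s + t} \<in> pair_indep s t"
      using assms full by (auto simp: pair_indep_def)
    show "card I \<le> card {..<s + t}" if "I \<in> pair_indep s t" for I
      using that card_touched_pairs_le[of s I]
      by (auto simp: pair_indep_def card_eq_touched_plus_full)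
  qed (use assms finite_pair_indep in auto)
  have "{..<2 * s} - {..<s} = {s..<2 * s}"
    by auto
  then show ?thesis
    using 1 2 3 by (simp add: connectivity_def)
qed

section \<open>Width at the middle level\<close>

lemma width_pair_indep_ge:
  assumes "3 \<le> s"
  shows "s \<le> width [0..<2 * s] (ZDD [0..<2 * s] (pair_indep s (s - 2))) s"
proof -
  let ?es = "[0..<2 * s]" and ?\<I> = "pair_indep s (s - 2)"
  define path where "path j = map (\<lambda>k. k \<noteq> j) [0..<s]" for j
  have sel: "selected ?es (path j) = {..<s} - {j}" for j
  proof -
    have "\<exists>k. x = ?es ! k \<and> k < length (path j) \<and> path j ! k" if "x < s" "x \<noteq> j" for x
      using that by (intro exI[of _ x]) (simp add: path_def)
    then show ?thesis
      by (auto simp: selected_def path_def)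
  qed
  have res: "residual ?es ?\<I> (path j) = {Y. Y \<subseteq> {s..<2 * s} \<and> ({..<s} - {j}) \<union> Y \<in> ?\<I>}" for j
    unfolding residual_def sel by (simp add: path_def)
  \<comment> \<open>The full pairs of the union are all except \<open>j\<close> and
    \<open>k\<close>. Their number exceeds \<open>s - 2\<close> exactly when \<open>j\<close> and
    \<open>k\<close> coincide.\<close>
  have omit: "{s..<2 * s} - {s + k} \<in> residual ?es ?\<I> (path j) \<longleftrightarrow> j \<noteq> k"
    if "j < s" "k < s" for j k
  proof -
    let ?I = "({..<s} - {j}) \<union> ({s..<2 * s} - {s + k})"
    have "full_pairs s ?I = {..<s} - {j, k}"
      by (auto simp: full_pairs_def)
    moreover have "card ({..<s} - {j, k}) = (if j = k then s - 1 else s - 2)"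
      using that by (auto simp: card_Diff_subset)
    moreover have "?I \<subseteq> {..<2 * s}"
      by auto
    ultimately have "?I \<in> ?\<I> \<longleftrightarrow> j \<noteq> k"
      using assms unfolding pair_indep_def by (simp split: if_splits)
    then show ?thesis
      unfolding res by blast
  qed
  have "inj_on (\<lambda>j. residual ?es ?\<I> (path j)) {..<s}"
    by (rule inj_onI) (metis omit lessThan_iff)
  then have "s = card (residual ?es ?\<I> ` path ` {..<s})"
    by (simp add: image_image card_image)
  also have "\<dots> \<le> width ?es (ZDD ?es ?\<I>) s"
  proof (rule card_residual_le_width)
    fix p assume "p \<in> path ` {..<s}"
    then obtain j where p: "p = path j" by blast
    \<comment> \<open>The next element is \<open>s\<close>, whose partner is \<open>0\<close>.
      Adding it fills at most one pair, which the bound \<open>s - 2\<close> permits because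
      \<open>s\<close> is at least 3; so the 1-family is nonempty.\<close>
    have "full_pairs s (insert s ({..<s} - {j})) \<subseteq> {0}"
      by (auto simp: full_pairs_def)
    then have "card (full_pairs s (insert s ({..<s} - {j}))) \<le> card {0::nat}"
      by (intro card_mono) auto
    then have "{s} \<in> residual ?es ?\<I> (path j)"
      unfolding res using assms by (auto simp: pair_indep_def)
    moreover have len: "length (path j) = s"
      by (simp add: path_def)
    ultimately have "{} \<in> residual ?es ?\<I> (path j @ [True])"
      using assms by (simp add: residual_snoc_True)
    with len show "length p = s \<and> residual ?es ?\<I> (p @ [True]) \<noteq> {}"
      unfolding p by blast
  qed (use assms in auto)
  finally show ?thesis .
qed

theorem theorem4p9:
  "\<not> (\<exists>f :: nat \<Rightarrow> nat.
        \<forall>(E :: nat set) \<I> es i.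
          matroid E \<I> \<longrightarrow> transversal E \<I> \<longrightarrow> distinct es \<longrightarrow> set es = E \<longrightarrow> i < length es \<longrightarrow>
            width es (ZDD es \<I>) i \<le> f (connectivity E \<I> (set (take i es))))"
proof
  assume "\<exists>f :: nat \<Rightarrow> nat. \<forall>(E :: nat set) \<I> es i.
          matroid E \<I> \<longrightarrow> transversal E \<I> \<longrightarrow> distinct es \<longrightarrow> set es = E \<longrightarrow> i < length es \<longrightarrow>
            width es (ZDD es \<I>) i \<le> f (connectivity E \<I> (set (take i es)))"
  then obtain f :: "nat \<Rightarrow> nat" where f: "\<And>(E :: nat set) \<I> es i.
      matroid E \<I> \<Longrightarrow> transversal E \<I> \<Longrightarrow> distinct es \<Longrightarrow> set es = E \<Longrightarrow> i < length es \<Longrightarrow>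
        width es (ZDD es \<I>) i \<le> f (connectivity E \<I> (set (take i es)))"
    by blast
  \<comment> \<open>The connectivity stays 2 for every such \<open>s\<close>, so any
    \<open>s\<close> above \<open>f 2\<close> contradicts the bound; the summand 3 also meets the
    hypothesis of \<open>width_pair_indep_ge\<close>.\<close>
  define s where "s = f 2 + 3"
  let ?\<I> = "pair_indep s (s - 2)"
  have "s \<le> width [0..<2 * s] (ZDD [0..<2 * s] ?\<I>) s"
    by (rule width_pair_indep_ge) (simp add: s_def)
  also have "\<dots> \<le> f (connectivity {..<2 * s} ?\<I> (set (take s [0..<2 * s])))"
    by (rule f[OF matroid_pair_indep transversal_pair_indep]) (auto simp: s_def)
  also have "set (take s [0..<2 * s]) = {..<s}"
    by auto
  also have "connectivity {..<2 * s} ?\<I> {..<s} = 2"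
    by (subst connectivity_pair_indep) (simp_all add: s_def)
  finally show False
    by (simp add: s_def)
qed

end
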